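(* For every Tychonoff space $X$ there exists a Tychonoff space $Y$ with $\pi_0(Y)\cong X$ (homeomorphic) such that, for every topological property $\mathscr{P}$ that is inversely preserved by perfect maps, if $X$ has $\mathscr{P}$ then $Y$ has $\mathscr{P}$.
   Context: For a topological space $Y$, the path-component space $\pi_0(Y)$ is the set of path components of $Y$ equipped with the quotient topology with respect to the map $Y\to\pi_0(Y)$ sending each point to its path component. A Tychonoff space is a completely regular Hausdorff space. A map (continuous function) $f:A\to B$ is perfect if $A$ is Hausdorff, $f$ is a closed map, and $f^{-1}(b)$ is compact for each $b\in B$. A topological property $\mathscr{P}$ is inversely preserved by perfect maps if whenever $f:A\to B$ is a perfect map and $B$ has property $\mathscr{P}$, then so does $A=f^{-1}(B)$. *)

theory Defs
  imports "HOL-Analysis.Analysis"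
begin

definition Tychonoff_space :: "'a topology \<Rightarrow> bool" where
  "Tychonoff_space X \<longleftrightarrow> completely_regular_space X \<and> Hausdorff_space X"

definition pi0 :: "'a topology \<Rightarrow> 'a set topology" where
  "pi0 Y = topology (\<lambda>\<U>. \<U> \<subseteq> path_components_of Y \<and>
     openin Y {y \<in> topspace Y. path_component_of_set Y y \<in> \<U>})"

lemma openin_pi0:
  "openin (pi0 Y) \<U> \<longleftrightarrow> \<U> \<subseteq> path_components_of Y \<and>
     openin Y {y \<in> topspace Y. path_component_of_set Y y \<in> \<U>}"
proof -
  let ?q = "path_component_of_set Y"
  let ?L = "\<lambda>\<U>. \<U> \<subseteq> path_components_of Y \<and> openin Y {y \<in> topspace Y. ?q y \<in> \<U>}"
  have "istopology ?L"
    unfolding istopology_def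
  proof (intro conjI allI impI)
    fix S T assume S: "?L S" and T: "?L T"
    have "{y \<in> topspace Y. ?q y \<in> S \<inter> T} =
        {y \<in> topspace Y. ?q y \<in> S} \<inter> {y \<in> topspace Y. ?q y \<in> T}" by blast
    with S T show "openin Y {y \<in> topspace Y. ?q y \<in> S \<inter> T}" by auto
    from S show "S \<inter> T \<subseteq> path_components_of Y" by blast
  next
    fix K assume K: "\<forall>S\<in>K. ?L S"
    have "{y \<in> topspace Y. ?q y \<in> \<Union>K} = (\<Union>S\<in>K. {y \<in> topspace Y. ?q y \<in> S})" by blast
    moreover have "openin Y (\<Union>S\<in>K. {y \<in> topspace Y. ?q y \<in> S})" using K by blast
    ultimately show "openin Y {y \<in> topspace Y. ?q y \<in> \<Union>K}" by simp
    from K show "\<Union>K \<subseteq> path_components_of Y" by blast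
  qed
  then show ?thesis
    unfolding pi0_def by (simp add: topology_inverse')
qed

lemma topspace_pi0: "topspace (pi0 Y) = path_components_of Y"
proof -
  have "{y \<in> topspace Y. path_component_of_set Y y \<in> path_components_of Y} = topspace Y"
    by (auto simp: path_components_of_def)
  then have "openin (pi0 Y) (path_components_of Y)"
    by (simp add: openin_pi0)
  then show ?thesis
    by (meson openin_pi0 openin_subset openin_topspace subset_antisym)
qed

lemma quotient_map_pi0: "quotient_map Y (pi0 Y) (path_component_of_set Y)"
  by (auto simp: quotient_map_def topspace_pi0 openin_pi0 path_components_of_def)

text \<open>Unlike the library's \<^const>\<open>perfect_map\<close>, the maps here need not be surjective,
  but their domain is required to be Hausdorff.\<close>

definition Hausdorff_perfect_map :: "'a topology \<Rightarrow> 'b topology \<Rightarrow> ('a \<Rightarrow> 'b) \<Rightarrow> bool" where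
  "Hausdorff_perfect_map A B f \<longleftrightarrow>
     Hausdorff_space A \<and> continuous_map A B f \<and> closed_map A B f \<and>
     (\<forall>b \<in> topspace B. compactin A {a \<in> topspace A. f a = b})"

text \<open>A predicate in HOL concerns spaces carried by subsets of a single type, so a topological
  property is a homeomorphism-invariant predicate on the topologies over a type \<open>'u\<close>, which acts
  as a universe. A space over another type has the property if its copies over \<open>'u\<close> do.\<close>

definition topological_property :: "('u topology \<Rightarrow> bool) \<Rightarrow> bool" where
  "topological_property P \<longleftrightarrow> (\<forall>A B. A homeomorphic_space B \<longrightarrow> P A \<longrightarrow> P B)"

definition inversely_preserved_by_perfect_maps :: "('u topology \<Rightarrow> bool) \<Rightarrow> bool" where
  "inversely_preserved_by_perfect_maps P \<longleftrightarrow>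
     (\<forall>A B f. Hausdorff_perfect_map A B f \<longrightarrow> P B \<longrightarrow> P A)"

definition has_property :: "'a topology \<Rightarrow> ('u topology \<Rightarrow> bool) \<Rightarrow> bool" where
  "has_property X P \<longleftrightarrow> (\<exists>X'. X homeomorphic_space X' \<and> P X')"

lemma has_property_iff:
  assumes "topological_property P" "X homeomorphic_space X'"
  shows "has_property X P \<longleftrightarrow> P X'"
  using assms unfolding has_property_def topological_property_def
  by (meson homeomorphic_space_sym homeomorphic_space_trans)

text \<open>A universe containing copies of all spaces over \<open>'a\<close>, and large enough for products of such
  a space with real cubes indexed by its real-valued functions. As \<open>'a\<close> may be any type
  into which the points of a given space embed, the universe can be taken arbitrarily large.\<close>

type_synonym 'a universe = "'a \<times> (('a \<Rightarrow> real) \<Rightarrow> real)"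

lemma universe_copy:
  fixes X :: "'a topology"
  obtains X' :: "'a universe topology" where "X homeomorphic_space X'"
proof
  let ?c = "(\<lambda>_. 0) :: ('a \<Rightarrow> real) \<Rightarrow> real"
  show "X homeomorphic_space prod_topology X (discrete_topology {?c})"
    unfolding homeomorphic_space_def homeomorphic_maps_def
    by (rule exI[of _ "\<lambda>x. (x, ?c)"], rule exI[of _ fst])
       (auto simp: continuous_map_pairwise o_def continuous_map_fst)
qed

end

theory Submission
  imports Defs
begin

text \<open>
  Let \<open>C(X)\<close> be the set of continuous real functions on \<open>X\<close>, and let \<open>Y\<close> consist of the points
  \<open>(x, y)\<close> of \<open>X \<times> [-1, 1]\<^bsup>C(X)\<^esup>\<close> such that every coordinate \<open>y f\<close> with \<open>f x \<noteq> 0\<close> equals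
  \<open>sin (1 / f x)\<close>. In the coordinate \<open>f\<close> one sees the closed topologist's sine curve
  (both branches, together with the limit segment over \<open>0\<close>), pulled back along \<open>f\<close>.

  The projection \<open>Y \<rightarrow> X\<close> is perfect, since \<open>Y\<close> is closed in the product of \<open>X\<close> with a compact
  cube. Its fibres are products of points and intervals, hence path connected. Conversely, a path
  in \<open>Y\<close> cannot leave a fibre: if its ends lay over distinct points \<open>a\<close> and \<open>b\<close>, complete
  regularity would give some \<open>f \<in> C(X)\<close> with \<open>f a = 0\<close> and \<open>f b = 1\<close>, and the coordinates
  \<open>f x\<close> and \<open>y f\<close> along the path would be a path in the plane that runs from the limit segment
  of the topologist's sine curve into its oscillating part, which is impossible
  (\<open>no_path_off_the_limit_segment\<close>). So the path components of \<open>Y\<close> are exactly the fibres, and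
  as perfect surjections are quotient maps, \<open>pi0 Y\<close> is homeomorphic to \<open>X\<close>
  (\<open>quotient_maps_same_fibres_homeomorphic\<close>). Any property inversely preserved by perfect maps
  passes from \<open>X\<close> to \<open>Y\<close> along the projection.
\<close>

section \<open>The topologist's sine curve\<close>

lemma small_preimages_of_sine_values:
  fixes e :: real
  assumes "0 < e"
  obtains p q where "0 < p" "p < e" "sin (inverse p) = 1" "0 < q" "q < e" "sin (inverse q) = -1"
proof -
  obtain n :: nat where n: "inverse e < real n"
    using reals_Archimedean2 by blast
  (* sin is 1 at P and -1 at Q, whatever the number n of full turns. *)
  define P where "P = pi / 2 + 2 * real n * pi"
  define Q where "Q = 3 / 2 * pi + 2 * real n * pi"
  have "real n \<le> 2 * real n * pi"
    using mult_left_mono[of 1 "2 * pi" "real n"] pi_gt3 by (simp add: ac_simps)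
  then have big: "inverse e < P" "inverse e < Q"
    using n pi_gt_zero unfolding P_def Q_def by linarith+
  have pos: "0 < inverse e"
    using assms by simp
  have "inverse P < e" "inverse Q < e"
    using big pos by (metis inverse_inverse_eq less_imp_inverse_less)+
  moreover have "sin P = 1" "sin Q = -1"
    unfolding P_def Q_def sin_add sin_3over2_pi cos_3over2_pi sin_2npi cos_2npi by simp_all
  ultimately show ?thesis
    using that[of "inverse P" "inverse Q"] big pos by simp
qed

text \<open>After the last time \<open>c\<close> at which \<open>u\<close> vanishes, \<open>u\<close> takes all small positive values at times
  arbitrarily close to \<open>c\<close>, so \<open>v\<close> takes both values \<open>1\<close> and \<open>-1\<close> arbitrarily close to \<open>c\<close> and
  cannot be continuous there.\<close>

lemma no_path_off_the_limit_segment: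
  fixes u v :: "real \<Rightarrow> real"
  assumes u: "continuous_on {0..1} u" and v: "continuous_on {0..1} v"
    and "u 0 = 0" and "0 < u 1"
    and sine: "\<And>t. \<lbrakk>t \<in> {0..1}; u t \<noteq> 0\<rbrakk> \<Longrightarrow> v t = sin (inverse (u t))"
  shows False
proof -
  let ?Z = "{t \<in> {0..1}. u t = 0}"
  have "closed ?Z"
    using continuous_closed_preimage_constant[OF u] by simp
  then have "compact ({0..1} \<inter> ?Z)"
    by (intro compact_Int_closed compact_Icc)
  also have "{0..1} \<inter> ?Z = ?Z"
    by auto
  finally have "compact ?Z" .
  moreover have "0 \<in> ?Z"
    using \<open>u 0 = 0\<close> by simp
  ultimately obtain c where c: "c \<in> ?Z" and last: "\<And>t. t \<in> ?Z \<Longrightarrow> t \<le> c"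
    using compact_attains_sup[of ?Z] by blast
  have "c \<noteq> 1"
    using \<open>0 < u 1\<close> c by auto
  then have "c < 1"
    using c by auto
  obtain d where "0 < d" and d: "\<And>t. \<lbrakk>t \<in> {0..1}; dist t c < d\<rbrakk> \<Longrightarrow> dist (v t) (v c) < 1"
    using v[unfolded continuous_on_iff, rule_format, of c 1] c by auto
  define b where "b = min 1 (c + d / 2)"
  have b: "c < b" "b \<le> 1" "b < c + d"
    using \<open>c < 1\<close> \<open>0 < d\<close> by (auto simp: b_def)
  have ivt: "\<exists>t. s \<le> t \<and> t \<le> r \<and> u t = y"
    if "0 \<le> s" "s \<le> r" "r \<le> 1" "u s \<le> y" "y \<le> u r" for s r y
    using IVT'[of u s y r] that continuous_on_subset[OF u, of "{s..r}"] by auto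
  have "0 < u b"
  proof (rule ccontr)
    assume "\<not> 0 < u b"
    then obtain t where "b \<le> t" "t \<le> 1" "u t = 0"
      using ivt[of b 1 0] b c \<open>0 < u 1\<close> by auto
    then show False
      using last[of t] b c by auto
  qed
  then obtain p q where p: "0 < p" "p < u b" "sin (inverse p) = 1"
    and q: "0 < q" "q < u b" "sin (inverse q) = -1"
    using small_preimages_of_sine_values by metis
  have close: "\<exists>t. v t = sin (inverse y) \<and> dist (v t) (v c) < 1" if y: "0 < y" "y < u b" for y
  proof -
    obtain t where t: "c \<le> t" "t \<le> b" "u t = y"
      using ivt[of c b y] y b c by auto
    then have "t \<in> {0..1}" "dist t c < d"
      using b c by (auto simp: dist_real_def)
    then show ?thesis
      using d sine t y by (metis less_irrefl)
  qed
  show False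
    using close[of p] close[of q] p q by (auto simp: dist_real_def)
qed

text \<open>Multiplied by \<open>t\<close>, the equation \<open>s = sin (1 / t)\<close> of the sine curve has continuous sides, also
  at \<open>t = 0\<close>, where it becomes void. Hence the curve together with its limit segment is closed in
  \<open>\<real> \<times> [-1, 1]\<close>, being the set on which two continuous functions agree.\<close>

lemma continuous_damped_sine: "continuous_on UNIV (\<lambda>t::real. t * sin (inverse t))"
proof -
  have "isCont (\<lambda>t::real. t * sin (inverse t)) a" for a
  proof (cases "a = 0")
    case True
    have "((\<lambda>t::real. t * sin (inverse t)) \<longlongrightarrow> 0) (at 0)"
    proof (rule Lim_null_comparison)
      show "\<forall>\<^sub>F t in at 0. norm (t * sin (inverse t)) \<le> \<bar>t\<bar>"
        by (auto simp: abs_mult intro!: always_eventually mult_left_le)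
      show "((\<lambda>t::real. \<bar>t\<bar>) \<longlongrightarrow> 0) (at 0)"
        using tendsto_rabs[OF tendsto_ident_at, of "0::real" UNIV] by simp
    qed
    with True show ?thesis
      by (simp add: isCont_def)
  next
    case False
    then show ?thesis
      by (intro continuous_intros) auto
  qed
  then show ?thesis
    by (simp add: continuous_on_eq_continuous_at)
qed

section \<open>Quotient maps and perfect maps\<close>

lemma quotient_maps_same_fibres_homeomorphic:
  assumes p: "quotient_map Y A p" and q: "quotient_map Y B q"
    and fibres: "\<And>x y. \<lbrakk>x \<in> topspace Y; y \<in> topspace Y\<rbrakk> \<Longrightarrow> p x = p y \<longleftrightarrow> q x = q y"
  shows "A homeomorphic_space B"
proof -
  obtain g where g: "continuous_map A B g" "\<And>x. x \<in> topspace Y \<Longrightarrow> g (p x) = q x"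
    using quotient_map_lift_exists[OF p quotient_imp_continuous_map[OF q]] fibres by metis
  obtain h where h: "continuous_map B A h" "\<And>x. x \<in> topspace Y \<Longrightarrow> h (q x) = p x"
    using quotient_map_lift_exists[OF q quotient_imp_continuous_map[OF p]] fibres by metis
  have "p ` topspace Y = topspace A" "q ` topspace Y = topspace B"
    using p q by (auto simp: quotient_map_def)
  then have "homeomorphic_maps A B g h"
    using g h unfolding homeomorphic_maps_def by (metis (no_types, lifting) imageE)
  then show ?thesis
    by (auto simp: homeomorphic_space_def)
qed

lemma proper_map_fst_compact:
  assumes "compact_space K"
  shows "proper_map (prod_topology X K) X fst"
  unfolding proper_map_def
proof (intro conjI ballI)
  show "closed_map (prod_topology X K) X fst"
    using assms by (rule closed_map_fst)
  fix a assume "a \<in> topspace X"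
  then have "{z \<in> topspace (prod_topology X K). fst z = a} = {a} \<times> topspace K"
    by auto
  then show "compactin (prod_topology X K) {z \<in> topspace (prod_topology X K). fst z = a}"
    using assms \<open>a \<in> topspace X\<close> by (simp add: compactin_Times compact_space_def)
qed

lemma proper_map_from_closed_subtopology:
  assumes f: "proper_map X Y f" and S: "closedin X S"
  shows "proper_map (subtopology X S) Y f"
proof -
  have "proper_map (subtopology X S) X id"
    using S closedin_subset[OF S] by (simp add: proper_map_inclusion closed_Int_compactin)
  then show ?thesis
    using proper_map_compose[OF _ f] by fastforce
qed

lemma Hausdorff_perfect_map_iff_proper_map:
  "Hausdorff_perfect_map A B f \<longleftrightarrow> Hausdorff_space A \<and> continuous_map A B f \<and> proper_map A B f"
  by (auto simp: Hausdorff_perfect_map_def proper_map_def)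

text \<open>A property over the universe type refers to \<open>X\<close> only through a copy, so the perfect map is
  first composed with the homeomorphism onto that copy.\<close>

lemma has_property_perfect_preimage:
  fixes Y :: "'u topology" and P :: "'u topology \<Rightarrow> bool"
  assumes f: "Hausdorff_perfect_map Y X f"
    and P: "inversely_preserved_by_perfect_maps P" and X: "has_property X P"
  shows "has_property Y P"
proof -
  obtain X' h where h: "homeomorphic_map X X' h" and "P X'"
    using X unfolding has_property_def homeomorphic_space by blast
  have "Hausdorff_perfect_map Y X' (h \<circ> f)"
    using f h unfolding Hausdorff_perfect_map_iff_proper_map
    by (metis continuous_map_compose homeomorphic_imp_continuous_map homeomorphic_imp_proper_map
        proper_map_compose)
  then have "P Y"
    using P \<open>P X'\<close> unfolding inversely_preserved_by_perfect_maps_def by blast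
  then show ?thesis
    unfolding has_property_def using homeomorphic_space_refl by blast
qed

section \<open>The space of sine curves over a space\<close>

abbreviation sine_cube :: "'a topology \<Rightarrow> (('a \<Rightarrow> real) \<Rightarrow> real) topology" where
  "sine_cube X \<equiv> product_topology (\<lambda>_. top_of_set {-1..1}) {f. continuous_map X euclideanreal f}"

definition sine_space :: "'a topology \<Rightarrow> 'a universe topology" where
  "sine_space X = subtopology (prod_topology X (sine_cube X))
     {(x, y). \<forall>f. continuous_map X euclideanreal f \<longrightarrow> f x \<noteq> 0 \<longrightarrow> y f = sin (inverse (f x))}"

lemma compact_space_sine_cube: "compact_space (sine_cube X)"
  by (auto simp: compact_space_product_topology compact_space_subtopology)

lemma continuous_map_sine_coordinate:
  assumes "continuous_map X euclideanreal f"
  shows "continuous_map (sine_cube X) euclideanreal (\<lambda>y. y f)"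
  using continuous_map_product_projection[of f "{f. continuous_map X euclideanreal f}"
      "\<lambda>_. top_of_set {-1..1::real}"] assms
  by (auto simp: continuous_map_in_subtopology)

lemma topspace_sine_space:
  "topspace (sine_space X) =
    {(x, y). x \<in> topspace X \<and> y \<in> topspace (sine_cube X) \<and>
      (\<forall>f. continuous_map X euclideanreal f \<longrightarrow> f x \<noteq> 0 \<longrightarrow> y f = sin (inverse (f x)))}"
  by (auto simp: sine_space_def)

lemma continuous_map_fst_sine_space: "continuous_map (sine_space X) X fst"
  unfolding sine_space_def by (intro continuous_map_from_subtopology continuous_map_fst)

text \<open>The equations that cut out the space are closed conditions, one for each coordinate of the
  compact cube.\<close>

lemma proper_map_fst_sine_space: "proper_map (sine_space X) X fst"
proof -
  let ?T = "prod_topology X (sine_cube X)"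
  let ?C = "{f. continuous_map X euclideanreal f}"
  let ?Z = "\<lambda>f. {z \<in> topspace ?T. f (fst z) * snd z f = f (fst z) * sin (inverse (f (fst z)))}"
  have "closedin ?T (?Z f)" if f: "continuous_map X euclideanreal f" for f
  proof (rule closedin_continuous_maps_eq)
    have 1: "continuous_map ?T euclideanreal (\<lambda>z. f (fst z))"
      using continuous_map_compose[OF continuous_map_fst f] by (simp add: o_def)
    have 2: "continuous_map ?T euclideanreal (\<lambda>z. snd z f)"
      using continuous_map_compose[OF continuous_map_snd continuous_map_sine_coordinate[OF f]]
      by (simp add: o_def)
    show "continuous_map ?T euclideanreal (\<lambda>z. f (fst z) * snd z f)"
      by (rule continuous_map_real_mult[OF 1 2])
    show "continuous_map ?T euclideanreal (\<lambda>z. f (fst z) * sin (inverse (f (fst z))))"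
      using continuous_map_compose[OF 1, of euclideanreal "\<lambda>t. t * sin (inverse t)"]
        continuous_damped_sine by (simp add: o_def)
  qed auto
  then have closed: "closedin ?T (\<Inter>f\<in>?C. ?Z f)"
    by (intro closedin_INT) (auto intro: exI[of _ "\<lambda>_. 0"])
  have "sine_space X = subtopology ?T (\<Inter>f\<in>?C. ?Z f)"
    unfolding sine_space_def
    by (subst (1 2) subtopology_restrict[symmetric], rule arg_cong[of _ _ "subtopology ?T"]) auto
  then show ?thesis
    using proper_map_from_closed_subtopology[OF proper_map_fst_compact[OF compact_space_sine_cube] closed]
    by simp
qed

lemma fst_image_sine_space: "fst ` topspace (sine_space X) = topspace X"
proof (intro subset_antisym subsetI)
  fix x assume "x \<in> topspace X"
  (* Where f x = 0 any value in [-1, 1] will do; the convention inverse 0 = 0 supplies sin 0. *)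
  then have "(x, \<lambda>f\<in>{f. continuous_map X euclideanreal f}. sin (inverse (f x)))
      \<in> topspace (sine_space X)"
    by (auto simp: topspace_sine_space)
  then show "x \<in> fst ` topspace (sine_space X)"
    by force
qed (auto simp: topspace_sine_space)

lemma Tychonoff_space_sine_space:
  assumes "Tychonoff_space X"
  shows "Tychonoff_space (sine_space X)"
  using assms unfolding Tychonoff_space_def sine_space_def
  by (auto intro!: completely_regular_space_subtopology Hausdorff_space_subtopology
      simp: completely_regular_space_prod_topology Hausdorff_space_prod_topology
        completely_regular_space_product_topology Hausdorff_space_product_topology
        metrizable_imp_completely_regular_space metrizable_space_subtopology
        metrizable_space_euclidean)

text \<open>In each coordinate the fibre is a point or the whole interval \<open>[-1, 1]\<close>, so it contains the
  straight segment between any two of its points.\<close>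

lemma path_component_of_sine_space_same_fibre:
  assumes y: "(x, y) \<in> topspace (sine_space X)" and z: "(x, z) \<in> topspace (sine_space X)"
  shows "path_component_of (sine_space X) (x, y) (x, z)"
proof -
  let ?C = "{f. continuous_map X euclideanreal f}"
  define g where "g t = (x, \<lambda>f\<in>?C. (1 - t) * y f + t * z f)" for t :: real
  have seg: "(1 - t) * a + t * b \<in> {-1..1}"
    if "t \<in> {0..1}" "a \<in> {-1..1}" "b \<in> {-1..1}" for t a b :: real
    using convexD_alt[of "{-1..1::real}" a b t] that by (simp add: algebra_simps)
  have yz: "x \<in> topspace X" "y \<in> extensional ?C" "z \<in> extensional ?C"
    "\<And>f. continuous_map X euclideanreal f \<Longrightarrow> y f \<in> {-1..1}"
    "\<And>f. continuous_map X euclideanreal f \<Longrightarrow> z f \<in> {-1..1}"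
    using y z by (auto simp: topspace_sine_space PiE_def Pi_def)
  have "continuous_map (top_of_set {0..1}) (sine_cube X) (\<lambda>t. snd (g t))"
    unfolding continuous_map_componentwise
  proof (intro conjI ballI)
    show "(\<lambda>t. snd (g t)) ` topspace (top_of_set {0..1}) \<subseteq> extensional ?C"
      by (auto simp: g_def)
    fix f assume "f \<in> ?C"
    then show "continuous_map (top_of_set {0..1}) (top_of_set {-1..1}) (\<lambda>t. snd (g t) f)"
      using seg yz by (auto simp: g_def continuous_map_in_subtopology intro!: continuous_intros)
  qed
  then have "continuous_map (top_of_set {0..1}) (prod_topology X (sine_cube X)) g"
    using yz(1) by (auto simp: continuous_map_pairwise o_def g_def)
  moreover have "g t \<in> {(x, y). \<forall>f. continuous_map X euclideanreal f \<longrightarrow> f x \<noteq> 0 \<longrightarrow>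
      y f = sin (inverse (f x))}" for t
    using y z by (auto simp: g_def topspace_sine_space algebra_simps)
  ultimately have "pathin (sine_space X) g"
    by (auto simp: pathin_def sine_space_def continuous_map_in_subtopology)
  moreover have "g 0 = (x, y)" "g 1 = (x, z)"
    using yz by (auto simp: g_def extensional_restrict)
  ultimately show ?thesis
    unfolding path_component_of_def by blast
qed

text \<open>A function separating the two end fibres is itself one of the coordinates of the cube, and
  the path followed in this coordinate violates \<open>no_path_off_the_limit_segment\<close>. This is why all
  of \<open>C(X)\<close> is used as index set.\<close>

lemma sine_space_path_stays_in_fibre:
  assumes X: "Tychonoff_space X" and "path_component_of (sine_space X) w w'"
  shows "fst w = fst w'"
proof (rule ccontr)
  assume neq: "fst w \<noteq> fst w'"
  obtain g where g: "pathin (sine_space X) g" "g 0 = w" "g 1 = w'"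
    using assms(2) unfolding path_component_of_def by blast
  have in_space: "g t \<in> topspace (sine_space X)" if "t \<in> {0..1}" for t
    using g(1) that by (auto simp: pathin_def continuous_map_def)
  then have ends: "fst w \<in> topspace X" "fst w' \<in> topspace X"
    using in_space[of 0] in_space[of 1] g by (auto simp: topspace_sine_space)
  then have "closedin X {fst w'}"
    using X by (simp add: Tychonoff_space_def closedin_Hausdorff_singleton)
  moreover have "fst w \<in> topspace X - {fst w'}"
    using ends neq by simp
  ultimately have "\<exists>f::_ \<Rightarrow> real. continuous_map X (top_of_set {0..1}) f \<and> f (fst w) = 0 \<and> f ` {fst w'} \<subseteq> {1}"
    using X unfolding Tychonoff_space_def completely_regular_space_def by blast
  then obtain f where "continuous_map X (top_of_set {0..1::real}) f"
    and f01: "f (fst w) = 0" "f (fst w') = 1"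
    by auto
  then have f: "continuous_map X euclideanreal f"
    by (simp add: continuous_map_in_subtopology)
  have fst_g: "continuous_map (top_of_set {0..1}) X (fst \<circ> g)"
    using g(1) continuous_map_fst_sine_space unfolding pathin_def by (rule continuous_map_compose)
  have snd_g: "continuous_map (top_of_set {0..1}) (sine_cube X) (snd \<circ> g)"
    using g(1) unfolding pathin_def sine_space_def
    by (auto simp: continuous_map_in_subtopology continuous_map_pairwise)
  show False
  proof (rule no_path_off_the_limit_segment)
    show "continuous_on {0..1} (\<lambda>t. f (fst (g t)))"
      using continuous_map_compose[OF fst_g f] by (simp add: o_def)
    show "continuous_on {0..1} (\<lambda>t. snd (g t) f)"
      using continuous_map_compose[OF snd_g continuous_map_sine_coordinate[OF f]] by (simp add: o_def)
    show "snd (g t) f = sin (inverse (f (fst (g t))))" if "t \<in> {0..1}" "f (fst (g t)) \<noteq> 0" for t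
      using in_space[OF that(1)] that(2) f by (auto simp: topspace_sine_space)
  qed (use g f01 in auto)
qed

lemma pi0_sine_space_homeomorphic:
  assumes "Tychonoff_space X"
  shows "pi0 (sine_space X) homeomorphic_space X"
proof (rule quotient_maps_same_fibres_homeomorphic[OF quotient_map_pi0])
  show "quotient_map (sine_space X) X fst"
    using continuous_map_fst_sine_space proper_imp_closed_map[OF proper_map_fst_sine_space]
      fst_image_sine_space by (rule continuous_closed_imp_quotient_map)
  fix w w' assume w: "w \<in> topspace (sine_space X)" "w' \<in> topspace (sine_space X)"
  have "path_component_of_set (sine_space X) w = path_component_of_set (sine_space X) w' \<longleftrightarrow>
      path_component_of (sine_space X) w w'"
    using w by (metis (no_types) Collect_inj path_component_of_equiv)
  also have "\<dots> \<longleftrightarrow> fst w = fst w'"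
    using w sine_space_path_stays_in_fibre[OF assms] path_component_of_sine_space_same_fibre
    by (metis prod.collapse)
  finally show "path_component_of_set (sine_space X) w = path_component_of_set (sine_space X) w' \<longleftrightarrow>
      fst w = fst w'" .
qed

theorem corollary1p2:
  fixes X :: "'a topology"
  assumes "Tychonoff_space X"
  shows "\<exists>Y :: 'a universe topology.
    Tychonoff_space Y \<and> pi0 Y homeomorphic_space X \<and>
    (\<forall>P :: 'a universe topology \<Rightarrow> bool.
       topological_property P \<and> inversely_preserved_by_perfect_maps P \<longrightarrow>
       has_property X P \<longrightarrow> has_property Y P)"
proof (intro exI conjI allI impI)
  show Y: "Tychonoff_space (sine_space X)" and "pi0 (sine_space X) homeomorphic_space X"
    using assms by (rule Tychonoff_space_sine_space, rule pi0_sine_space_homeomorphic)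
  have "Hausdorff_perfect_map (sine_space X) X fst"
    using Y by (simp add: Hausdorff_perfect_map_iff_proper_map Tychonoff_space_def
        continuous_map_fst_sine_space proper_map_fst_sine_space)
  then show "has_property (sine_space X) P"
    if "topological_property P \<and> inversely_preserved_by_perfect_maps P" "has_property X P"
    for P :: "'a universe topology \<Rightarrow> bool"
    using that has_property_perfect_preimage by blast
qed

end
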